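(* Let $m\ge 0$ be an integer, let $K$ be an edge-path connected simplicial complex, and let $\Delta:K\to K^2$ be the diagonal map into the categorical product $K^2=K\times K$. Then $\mathrm{TC}^m(K)=\mathrm{hsecat}_m(\Delta)$.
   Context: Simplicial complexes are abstract simplicial complexes. Simplicial maps $f,g:A\to B$ are contiguous, $f\sim_c g$, if for every simplex $\{v_0,\dots,v_k\}$ of $A$ the set $\{f(v_0),\dots,f(v_k),g(v_0),\dots,g(v_k)\}$ is a simplex of $B$. They are in the same contiguity class, $f\sim g$, if there is a finite sequence of simplicial maps $f=f_0\sim_c f_1\sim_c\dots\sim_c f_n=g$ from $A$ to $B$. The categorical product $K\times L$ has as vertices the pairs $(v,w)$ of vertices of $K$ and $L$; a finite set of such pairs is a simplex iff its first coordinates form a simplex of $K$ and its second coordinates form a simplex of $L$. The $m$-discrete topological complexity $\mathrm{TC}^m(K)$ is the least integer $k\ge 0$ such that $K^2$ is covered by subcomplexes $\Omega_0,\dots,\Omega_k$ for each of which there exists a simplicial map $\sigma_j:\Omega_j\to K$ such that for every simplicial map $\eta_j:P\to\Omega_j$ from an $m$-dimensional simplicial complex $P$, $\Delta\circ\sigma_j\circ\eta_j\sim\iota_j\circ\eta_j$, where $\iota_j:\Omega_j\hookrightarrow K^2$ is the inclusion. For a simplicial map $\phi:K\to L$, the $m$-homotopy simplicial Svarc genus $\mathrm{hsecat}_m(\phi)$ is the least integer $n\ge 0$ such that $L$ is covered by subcomplexes $L_0,\dots,L_n$ with the property that for each $j$ and every simplicial map $\eta:P\to L_j$ from an $m$-dimensional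 simplicial complex $P$, there is a simplicial map $s:P\to K$ with $\phi\circ s\sim\iota_j\circ\eta$, where $\iota_j:L_j\hookrightarrow L$ is the inclusion. Both invariants are $\infty$ if no such cover exists. *)

theory Defs
  imports "HOL-Library.Extended_Nat"
begin

text \<open>A complex is given by its set of simplices (nonempty finite sets); its vertex set
  is \<open>\<Union>K\<close>, and \<open>v\<close> is a vertex iff \<open>{v} \<in> K\<close>. The empty complex is allowed.\<close>

definition abstract_complex :: "'a set set \<Rightarrow> bool" where
  "abstract_complex K \<longleftrightarrow>
     (\<forall>s\<in>K. finite s \<and> s \<noteq> {}) \<and> (\<forall>s\<in>K. \<forall>t. t \<subseteq> s \<and> t \<noteq> {} \<longrightarrow> t \<in> K)"

definition subcomplex :: "'a set set \<Rightarrow> 'a set set \<Rightarrow> bool" where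
  "subcomplex A K \<longleftrightarrow> abstract_complex A \<and> A \<subseteq> K"

definition has_dimension :: "'a set set \<Rightarrow> nat \<Rightarrow> bool" where
  "has_dimension P m \<longleftrightarrow> (\<forall>s\<in>P. card s \<le> m + 1) \<and> (\<exists>s\<in>P. card s = m + 1)"

definition edge_path_connected :: "'a set set \<Rightarrow> bool" where
  "edge_path_connected K \<longleftrightarrow> (\<forall>v\<in>\<Union>K. \<forall>w\<in>\<Union>K. (\<lambda>x y. {x, y} \<in> K)\<^sup>*\<^sup>* v w)"

text \<open>A simplicial map is a total function of which only the values on vertices matter:
  two functions that agree on the vertices are contiguous as soon as one of them is simplicial.\<close>

definition simplicial_map :: "'a set set \<Rightarrow> 'b set set \<Rightarrow> ('a \<Rightarrow> 'b) \<Rightarrow> bool" where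
  "simplicial_map A B f \<longleftrightarrow> (\<forall>s\<in>A. f ` s \<in> B)"

definition contiguous :: "'a set set \<Rightarrow> 'b set set \<Rightarrow> ('a \<Rightarrow> 'b) \<Rightarrow> ('a \<Rightarrow> 'b) \<Rightarrow> bool" where
  "contiguous A B f g \<longleftrightarrow>
     simplicial_map A B f \<and> simplicial_map A B g \<and> (\<forall>s\<in>A. f ` s \<union> g ` s \<in> B)"

definition same_contiguity_class ::
    "'a set set \<Rightarrow> 'b set set \<Rightarrow> ('a \<Rightarrow> 'b) \<Rightarrow> ('a \<Rightarrow> 'b) \<Rightarrow> bool" where
  "same_contiguity_class A B f g \<longleftrightarrow>
     simplicial_map A B f \<and> simplicial_map A B g \<and> (contiguous A B)\<^sup>*\<^sup>* f g"

definition cat_prod :: "'a set set \<Rightarrow> 'b set set \<Rightarrow> ('a \<times> 'b) set set" where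
  "cat_prod K L = {s. finite s \<and> fst ` s \<in> K \<and> snd ` s \<in> L}"

definition diagonal_map :: "'a \<Rightarrow> 'a \<times> 'a" where
  "diagonal_map v = (v, v)"

definition covered_by :: "'a set set \<Rightarrow> nat \<Rightarrow> (nat \<Rightarrow> 'a set set) \<Rightarrow> bool" where
  "covered_by L n A \<longleftrightarrow> (\<forall>j\<le>n. subcomplex (A j) L) \<and> (\<Union>j\<le>n. A j) = L"

text \<open>The test complexes \<open>P\<close> below should have vertices of arbitrary type, which a HOL formula
  cannot quantify over. For maps into a complex on type \<open>'b\<close> it suffices to take the vertices
  of \<open>P\<close> in \<open>'b + nat\<close>: every map from an \<open>m\<close>-dimensional complex factors through the
  disjoint union of its image and an \<open>m\<close>-simplex. The lemmas \<open>TC_piece_any_type\<close> and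
  \<open>hsecat_piece_any_type\<close> show that the restriction loses nothing. The inclusions \<open>\<iota>\<^sub>j\<close> are
  the identity function and are omitted.\<close>

definition TC_piece :: "nat \<Rightarrow> 'a set set \<Rightarrow> ('a \<times> 'a) set set \<Rightarrow> ('a \<times> 'a \<Rightarrow> 'a) \<Rightarrow> bool" where
  "TC_piece m K \<Omega> \<sigma> \<longleftrightarrow>
     (\<forall>(P :: ('a \<times> 'a + nat) set set) \<eta>.
        abstract_complex P \<and> has_dimension P m \<and> simplicial_map P \<Omega> \<eta> \<longrightarrow>
        same_contiguity_class P (cat_prod K K) (diagonal_map \<circ> \<sigma> \<circ> \<eta>) \<eta>)"

definition TC_m :: "nat \<Rightarrow> 'a set set \<Rightarrow> enat" where
  "TC_m m K = Inf (enat ` {k. \<exists>\<Omega>. covered_by (cat_prod K K) k \<Omega> \<and>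
     (\<forall>j\<le>k. \<exists>\<sigma>. simplicial_map (\<Omega> j) K \<sigma> \<and> TC_piece m K (\<Omega> j) \<sigma>)})"

definition hsecat_piece ::
    "nat \<Rightarrow> 'a set set \<Rightarrow> 'b set set \<Rightarrow> ('a \<Rightarrow> 'b) \<Rightarrow> 'b set set \<Rightarrow> bool" where
  "hsecat_piece m K L \<phi> A \<longleftrightarrow>
     (\<forall>(P :: ('b + nat) set set) \<eta>.
        abstract_complex P \<and> has_dimension P m \<and> simplicial_map P A \<eta> \<longrightarrow>
        (\<exists>s. simplicial_map P K s \<and> same_contiguity_class P L (\<phi> \<circ> s) \<eta>))"

definition hsecat_m :: "nat \<Rightarrow> 'a set set \<Rightarrow> 'b set set \<Rightarrow> ('a \<Rightarrow> 'b) \<Rightarrow> enat" where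
  "hsecat_m m K L \<phi> = Inf (enat ` {n. \<exists>A. covered_by L n A \<and>
     (\<forall>j\<le>n. hsecat_piece m K L \<phi> (A j))})"

lemma same_contiguity_class_precomp:
  assumes "simplicial_map P Q \<pi>" "same_contiguity_class Q B f g"
  shows "same_contiguity_class P B (f \<circ> \<pi>) (g \<circ> \<pi>)"
proof -
  have sim: "simplicial_map P B (h \<circ> \<pi>)" if "simplicial_map Q B h" for h
    using that assms(1) unfolding simplicial_map_def by (metis image_comp)
  have contig: "contiguous P B (h \<circ> \<pi>) (k \<circ> \<pi>)" if "contiguous Q B h k" for h k
    unfolding contiguous_def
  proof (intro conjI ballI)
    show "simplicial_map P B (h \<circ> \<pi>)" "simplicial_map P B (k \<circ> \<pi>)"
      using that sim by (simp_all add: contiguous_def)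
    fix s assume "s \<in> P"
    then have "\<pi> ` s \<in> Q" using assms(1) by (simp add: simplicial_map_def)
    then have "h ` \<pi> ` s \<union> k ` \<pi> ` s \<in> B" using that by (simp add: contiguous_def)
    then show "(h \<circ> \<pi>) ` s \<union> (k \<circ> \<pi>) ` s \<in> B" by (simp only: image_comp)
  qed
  have "(contiguous Q B)\<^sup>*\<^sup>* f g" using assms(2) by (simp add: same_contiguity_class_def)
  then have "(contiguous P B)\<^sup>*\<^sup>* (f \<circ> \<pi>) (g \<circ> \<pi>)"
  proof (induction rule: rtranclp_induct)
    case base
    show ?case by (rule rtranclp.rtrancl_refl)
  next
    case (step h k)
    have "(contiguous P B)\<^sup>*\<^sup>* (h \<circ> \<pi>) (k \<circ> \<pi>)"
      using contig [OF step.hyps(2)] by (rule r_into_rtranclp [of "contiguous P B"])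
    with step.IH show ?case by (rule rtranclp_trans)
  qed
  then show ?thesis using assms(2) sim by (simp add: same_contiguity_class_def)
qed

lemma factor_through_canonical_type:
  fixes P :: "'p set set" and A :: "'b set set"
  assumes P: "abstract_complex P" and dim: "has_dimension P m" and \<eta>: "simplicial_map P A \<eta>"
  obtains Q :: "('b + nat) set set" and \<theta>
  where "abstract_complex Q" "has_dimension Q m" "simplicial_map Q A \<theta>"
    "simplicial_map P Q (Inl \<circ> \<eta>)" "\<theta> \<circ> (Inl \<circ> \<eta>) = \<eta>"
proof -
  obtain s where s: "s \<in> P" using dim by (auto simp: has_dimension_def)
  have faces: "t \<in> P" if "r \<in> P" "t \<subseteq> r" "t \<noteq> {}" for r t
    using P that unfolding abstract_complex_def by blast
  have fin: "finite r" "r \<noteq> {}" if "r \<in> P" for r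
    using P that unfolding abstract_complex_def by blast+
  obtain v where v: "v \<in> s" using fin(2) [OF s] by blast
  then have "{v} \<in> P" using faces [OF s, of "{v}"] by simp
  then have "\<eta> ` {v} \<in> A" using \<eta> unfolding simplicial_map_def by (rule bspec [rotated])
  then have vA: "{\<eta> v} \<in> A" by simp
  define Q1 where "Q1 = (\<lambda>s. ((Inl \<circ> \<eta>) ` s :: ('b + nat) set)) ` P"
  define Q2 where "Q2 = {t :: ('b + nat) set. t \<subseteq> Inr ` {..m} \<and> t \<noteq> {}}"
  define \<theta> where "\<theta> = (\<lambda>x :: 'b + nat. case x of Inl b \<Rightarrow> b | Inr _ \<Rightarrow> \<eta> v)"
  have c1: "finite s \<and> s \<noteq> {}" if "s \<in> Q1 \<union> Q2" for s
    using that by (auto simp: Q1_def Q2_def intro: fin(1) finite_subset dest: fin(2))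
  have c2: "t \<in> Q1 \<union> Q2" if c: "s \<in> Q1 \<union> Q2" "t \<subseteq> s" "t \<noteq> {}" for s t
  proof (cases "s \<in> Q2")
    case True
    then show ?thesis using c by (auto simp: Q2_def)
  next
    case False
    then have "s \<in> Q1" using c(1) by simp
    then obtain r where r: "r \<in> P" "s = (Inl \<circ> \<eta>) ` r"
      unfolding Q1_def by blast
    have "t \<subseteq> (Inl \<circ> \<eta>) ` r" using c(2) r(2) by simp
    then obtain r' where r': "r' \<subseteq> r" "t = (Inl \<circ> \<eta>) ` r'" by (rule subset_imageE)
    then have "r' \<noteq> {}" using c(3) by auto
    then have "r' \<in> P" by (rule faces [OF r(1) r'(1)])
    then show ?thesis using r'(2) unfolding Q1_def by blast
  qed
  have "abstract_complex (Q1 \<union> Q2)"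
    unfolding abstract_complex_def using c1 c2 by blast
  moreover have "has_dimension (Q1 \<union> Q2) m"
    unfolding has_dimension_def
  proof
    show "\<forall>s\<in>Q1 \<union> Q2. card s \<le> m + 1"
    proof
      fix s assume "s \<in> Q1 \<union> Q2"
      then show "card s \<le> m + 1"
      proof
        assume "s \<in> Q1"
        then obtain r where r: "r \<in> P" "s = (Inl \<circ> \<eta>) ` r"
          unfolding Q1_def by blast
        have "finite r" using r(1) by (rule fin)
        then have "card s \<le> card r" using r(2) by (simp only: card_image_le)
        also have "\<dots> \<le> m + 1" using dim r(1) by (auto simp: has_dimension_def)
        finally show ?thesis .
      next
        assume "s \<in> Q2"
        then have "card s \<le> card (Inr ` {..m} :: ('b + nat) set)"
          by (auto simp: Q2_def intro!: card_mono)
        then show ?thesis by (simp add: card_image)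
      qed
    qed
    show "\<exists>s\<in>Q1 \<union> Q2. card s = m + 1"
      by (rule bexI [of _ "Inr ` {..m}"]) (auto simp: Q2_def card_image)
  qed
  moreover have "simplicial_map (Q1 \<union> Q2) A \<theta>"
    unfolding simplicial_map_def
  proof
    fix s assume "s \<in> Q1 \<union> Q2"
    then show "\<theta> ` s \<in> A"
    proof
      assume "s \<in> Q1"
      then show ?thesis using \<eta> by (auto simp: Q1_def \<theta>_def simplicial_map_def image_image)
    next
      assume "s \<in> Q2"
      then have "\<theta> ` s = {\<eta> v}" by (force simp: Q2_def \<theta>_def)
      then show ?thesis using vA by simp
    qed
  qed
  moreover have "simplicial_map P (Q1 \<union> Q2) (Inl \<circ> \<eta>)"
    by (simp add: simplicial_map_def Q1_def)
  moreover have "\<theta> \<circ> (Inl \<circ> \<eta>) = \<eta>" by (auto simp: \<theta>_def)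
  ultimately show thesis by (rule that)
qed

lemma TC_piece_any_type:
  fixes P :: "'p set set" and K :: "'a set set"
  assumes "TC_piece m K \<Omega> \<sigma>"
    and "abstract_complex P" "has_dimension P m" "simplicial_map P \<Omega> \<eta>"
  shows "same_contiguity_class P (cat_prod K K) (diagonal_map \<circ> \<sigma> \<circ> \<eta>) \<eta>"
proof -
  obtain Q :: "('a \<times> 'a + nat) set set" and \<theta>
    where Q: "abstract_complex Q" "has_dimension Q m" "simplicial_map Q \<Omega> \<theta>"
    "simplicial_map P Q (Inl \<circ> \<eta>)" and eq: "\<theta> \<circ> (Inl \<circ> \<eta>) = \<eta>"
    by (rule factor_through_canonical_type [OF assms(2-4)])
  have "same_contiguity_class Q (cat_prod K K) (diagonal_map \<circ> \<sigma> \<circ> \<theta>) \<theta>"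
    using assms(1) Q unfolding TC_piece_def by blast
  from same_contiguity_class_precomp [OF Q(4) this] show ?thesis
    by (simp only: comp_assoc eq)
qed

lemma hsecat_piece_any_type:
  fixes P :: "'p set set" and L :: "'b set set"
  assumes "hsecat_piece m K L \<phi> A"
    and "abstract_complex P" "has_dimension P m" "simplicial_map P A \<eta>"
  shows "\<exists>s. simplicial_map P K s \<and> same_contiguity_class P L (\<phi> \<circ> s) \<eta>"
proof -
  obtain Q :: "('b + nat) set set" and \<theta>
    where Q: "abstract_complex Q" "has_dimension Q m" "simplicial_map Q A \<theta>"
    "simplicial_map P Q (Inl \<circ> \<eta>)" and eq: "\<theta> \<circ> (Inl \<circ> \<eta>) = \<eta>"
    by (rule factor_through_canonical_type [OF assms(2-4)])
  obtain s where s: "simplicial_map Q K s" "same_contiguity_class Q L (\<phi> \<circ> s) \<theta>"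
    using assms(1) Q unfolding hsecat_piece_def by blast
  have "simplicial_map P K (s \<circ> (Inl \<circ> \<eta>))"
    using s(1) Q(4) unfolding simplicial_map_def by (metis image_comp)
  moreover have "same_contiguity_class P L (\<phi> \<circ> (s \<circ> (Inl \<circ> \<eta>))) \<eta>"
    using same_contiguity_class_precomp [OF Q(4) s(2)] by (simp only: comp_assoc eq)
  ultimately show ?thesis by blast
qed

end

theory Submission
  imports Defs
begin

text \<open>If \<open>\<Delta> \<circ> s \<sim> \<eta>\<close> for a map \<open>\<eta>\<close> into \<open>K\<^sup>2\<close>, then composing with the two projections gives
  \<open>pr\<^sub>1 \<circ> \<eta> \<sim> s \<sim> pr\<^sub>2 \<circ> \<eta>\<close>, and hence
  \<open>\<Delta> \<circ> pr\<^sub>1 \<circ> \<eta> = (pr\<^sub>1 \<circ> \<eta>, pr\<^sub>1 \<circ> \<eta>) \<sim> (pr\<^sub>1 \<circ> \<eta>, pr\<^sub>2 \<circ> \<eta>) = \<eta>\<close>. So the local lifts \<open>s\<close>, which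
  depend on \<open>\<eta>\<close>, can all be replaced by the first projection, which is simplicial on every
  subcomplex of \<open>K\<^sup>2\<close>.\<close>

lemma simplicial_map_comp:
  assumes "simplicial_map A B f" "simplicial_map B C g"
  shows "simplicial_map A C (g \<circ> f)"
  using assms unfolding simplicial_map_def by (metis image_comp)

lemma contiguous_postcomp:
  assumes "simplicial_map B C h" "contiguous A B f g"
  shows "contiguous A C (h \<circ> f) (h \<circ> g)"
  unfolding contiguous_def
proof (intro conjI ballI)
  show "simplicial_map A C (h \<circ> f)" "simplicial_map A C (h \<circ> g)"
    using assms by (auto simp: contiguous_def intro: simplicial_map_comp)
  fix s assume "s \<in> A"
  then have "h ` (f ` s \<union> g ` s) \<in> C"
    using assms by (simp add: contiguous_def simplicial_map_def)
  then show "(h \<circ> f) ` s \<union> (h \<circ> g) ` s \<in> C"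
    by (simp only: image_Un image_comp)
qed

text \<open>A chain of contiguities is carried over link by link. Stated for an arbitrary operation
  \<open>F\<close> on maps, so that it serves both postcomposition and pairing with a fixed
  map.\<close>

lemma same_contiguity_class_map:
  assumes "same_contiguity_class A B f g"
    and "\<And>f g. contiguous A B f g \<Longrightarrow> contiguous A' B' (F f) (F g)"
  shows "same_contiguity_class A' B' (F f) (F g)"
proof -
  \<comment> \<open>A simplicial map is contiguous to itself, so the assumption on \<open>F\<close>
    also shows that \<open>F\<close> preserves simplicial maps.\<close>
  have "contiguous A B k k" if "simplicial_map A B k" for k
    using that by (simp add: contiguous_def simplicial_map_def)
  then have "simplicial_map A' B' (F k)" if "simplicial_map A B k" for k
    using that assms(2) by (meson contiguous_def)
  moreover have "(contiguous A' B')\<^sup>*\<^sup>* (F f) (F g)" if "(contiguous A B)\<^sup>*\<^sup>* f g"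
    using that
  proof (induction rule: rtranclp_induct)
    case base
    show ?case by (rule rtranclp.rtrancl_refl)
  next
    case (step h k)
    from step.IH assms(2) [OF step.hyps(2)] show ?case
      by (rule rtranclp.rtrancl_into_rtrancl [of "contiguous A' B'"])
  qed
  ultimately show ?thesis
    using assms(1) by (simp add: same_contiguity_class_def)
qed

lemma same_contiguity_class_postcomp:
  assumes "simplicial_map B C h" "same_contiguity_class A B f g"
  shows "same_contiguity_class A C (h \<circ> f) (h \<circ> g)"
  using assms(2) contiguous_postcomp [OF assms(1)] by (rule same_contiguity_class_map)

lemma same_contiguity_class_sym:
  assumes "same_contiguity_class A B f g"
  shows "same_contiguity_class A B g f"
proof -
  have "symp (contiguous A B)"
    by (rule sympI) (simp add: contiguous_def Un_commute)
  then have "(contiguous A B)\<^sup>*\<^sup>* g f" if "(contiguous A B)\<^sup>*\<^sup>* f g"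
    using that by (metis symp_rtranclp sympD)
  then show ?thesis
    using assms by (simp add: same_contiguity_class_def)
qed

lemma same_contiguity_class_trans:
  assumes "same_contiguity_class A B f g" "same_contiguity_class A B g h"
  shows "same_contiguity_class A B f h"
  using assms unfolding same_contiguity_class_def by (meson rtranclp_trans)

lemma simplicial_map_fst: "simplicial_map (cat_prod K L) K fst"
  by (simp add: simplicial_map_def cat_prod_def)

lemma simplicial_map_snd: "simplicial_map (cat_prod K L) L snd"
  by (simp add: simplicial_map_def cat_prod_def)

lemma contiguous_pair:
  assumes "abstract_complex A" "simplicial_map A K h" "contiguous A L f g"
  shows "contiguous A (cat_prod K L) (\<lambda>x. (h x, f x)) (\<lambda>x. (h x, g x))"
proof -
  have "finite s" if "s \<in> A" for s
    using assms(1) that by (simp add: abstract_complex_def)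
  then show ?thesis
    using assms(2,3)
    by (auto simp: contiguous_def simplicial_map_def cat_prod_def image_Un image_image)
qed

lemma same_contiguity_class_pair:
  assumes "abstract_complex A" "simplicial_map A K h" "same_contiguity_class A L f g"
  shows "same_contiguity_class A (cat_prod K L) (\<lambda>x. (h x, f x)) (\<lambda>x. (h x, g x))"
  using assms(3) contiguous_pair [OF assms(1,2)] by (rule same_contiguity_class_map)

lemma same_contiguity_class_diagonal_fst:
  assumes P: "abstract_complex P"
    and s: "same_contiguity_class P (cat_prod K K) (diagonal_map \<circ> s) \<eta>"
  shows "same_contiguity_class P (cat_prod K K) (diagonal_map \<circ> fst \<circ> \<eta>) \<eta>"
proof -
  have "same_contiguity_class P K s (fst \<circ> \<eta>)"
    using same_contiguity_class_postcomp [OF simplicial_map_fst s]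
    by (simp add: comp_def diagonal_map_def)
  moreover have "same_contiguity_class P K s (snd \<circ> \<eta>)"
    using same_contiguity_class_postcomp [OF simplicial_map_snd s]
    by (simp add: comp_def diagonal_map_def)
  ultimately have "same_contiguity_class P K (fst \<circ> \<eta>) (snd \<circ> \<eta>)"
    by (blast intro: same_contiguity_class_sym same_contiguity_class_trans)
  moreover from this have "simplicial_map P K (fst \<circ> \<eta>)"
    by (simp add: same_contiguity_class_def)
  \<comment> \<open>The first coordinate stays fixed while the second runs along the chain from
    \<open>fst \<circ> \<eta>\<close> to \<open>snd \<circ> \<eta>\<close>.\<close>
  ultimately have "same_contiguity_class P (cat_prod K K)
      (\<lambda>x. ((fst \<circ> \<eta>) x, (fst \<circ> \<eta>) x)) (\<lambda>x. ((fst \<circ> \<eta>) x, (snd \<circ> \<eta>) x))"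
    using P by (intro same_contiguity_class_pair)
  then show ?thesis
    by (simp add: comp_def diagonal_map_def)
qed

lemma TC_piece_iff_hsecat_piece:
  assumes "\<Omega> \<subseteq> cat_prod K K"
  shows "(\<exists>\<sigma>. simplicial_map \<Omega> K \<sigma> \<and> TC_piece m K \<Omega> \<sigma>) \<longleftrightarrow>
    hsecat_piece m K (cat_prod K K) diagonal_map \<Omega>"
proof
  assume "\<exists>\<sigma>. simplicial_map \<Omega> K \<sigma> \<and> TC_piece m K \<Omega> \<sigma>"
  then obtain \<sigma> where "simplicial_map \<Omega> K \<sigma>" "TC_piece m K \<Omega> \<sigma>" by blast
  \<comment> \<open>The lift of \<open>\<eta>\<close> is
    \<open>\<sigma> \<circ> \<eta>\<close>.\<close>
  then show "hsecat_piece m K (cat_prod K K) diagonal_map \<Omega>"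
    unfolding hsecat_piece_def TC_piece_def by (metis simplicial_map_comp comp_assoc)
next
  assume "hsecat_piece m K (cat_prod K K) diagonal_map \<Omega>"
  then have "TC_piece m K \<Omega> fst"
    unfolding hsecat_piece_def TC_piece_def
    by (blast intro: same_contiguity_class_diagonal_fst)
  moreover have "simplicial_map \<Omega> K fst"
    using assms simplicial_map_fst [of K K] by (auto simp: simplicial_map_def)
  ultimately show "\<exists>\<sigma>. simplicial_map \<Omega> K \<sigma> \<and> TC_piece m K \<Omega> \<sigma>" by blast
qed

theorem theorem6p3:
  fixes m :: nat and K :: "'a set set"
  assumes "abstract_complex K" and "edge_path_connected K"
  shows "TC_m m K = hsecat_m m K (cat_prod K K) diagonal_map"
proof -
  \<comment> \<open>The same covers are admissible on both sides, so both infima are taken over the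
    same set, also when it is empty and the value is infinite.\<close>
  have "(covered_by (cat_prod K K) k \<Omega> \<and>
        (\<forall>j\<le>k. \<exists>\<sigma>. simplicial_map (\<Omega> j) K \<sigma> \<and> TC_piece m K (\<Omega> j) \<sigma>)) \<longleftrightarrow>
      (covered_by (cat_prod K K) k \<Omega> \<and>
        (\<forall>j\<le>k. hsecat_piece m K (cat_prod K K) diagonal_map (\<Omega> j)))" for k \<Omega>
    using TC_piece_iff_hsecat_piece [of "\<Omega> _" K m]
    by (auto simp: covered_by_def subcomplex_def)
  then show ?thesis
    unfolding TC_m_def hsecat_m_def by simp
qed

end
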